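(* Let $d\ge 1$, let $\epsilon>0$, and let $\{U_i^k\}_{i=1}^{d+1}$ be the unfolded TT-cores of the approximate accumulation $\hat{\mathcal X}^k$ (with $U_1^k,\dots,U_d^k$ having orthonormal columns) such that for every $\ell=1,\dots,k$ the approximation $\hat{\mathcal Y}^\ell$ of the existing tensor $\mathcal Y^\ell$ represented by these cores satisfies $\|\mathcal Y^\ell-\hat{\mathcal Y}^\ell\|_F\le\epsilon\|\mathcal Y^\ell\|_F$. Let $\mathcal Y^{k+1}\in\mathbb R^{n_1\times\cdots\times n_d\times n_{d+1}^{k+1}}$ be a new streamed tensor and let $\epsilon_1,\dots,\epsilon_d\ge0$ be the SVD truncation tolerances. Then the updated TT-cores $\{U_i^{k+1}\}_{i=1}^{d+1}$ computed by TT-ICE represent an approximate accumulation $\hat{\mathcal X}^{k+1}$ that still satisfies $$\|\mathcal Y^\ell-\hat{\mathcal Y}^\ell\|_F\le\epsilon\|\mathcal Y^\ell\|_F\qquad\text{for all }\ell=1,\dots,k,$$ where $\hat{\mathcal Y}^\ell$ now denotes the approximation of $\mathcal Y^\ell$ represented by the updated cores.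
   Context: Notation. $\|\cdot\|_F$ is the Frobenius norm (square root of the sum of squared entries) of a matrix or tensor. $\mathrm{reshape}(A,[m_1,\dots,m_p])$ rearranges the entries of $A$ into an array of size $m_1\times\cdots\times m_p$, using one fixed ordering convention for multi-indices (say column-major) everywhere. Tensor train (TT) format. The contraction of $\mathcal A\in\mathbb R^{n_1\times\cdots\times n_d}$ and $\mathcal B\in\mathbb R^{n_d\times\cdots\times n_D}$ sums over the last index of $\mathcal A$ and the first index of $\mathcal B$. A tensor is in TT-format with TT-cores $\mathcal G_i\in\mathbb R^{r_{i-1}\times n_i\times r_i}$ if it is the successive contraction of $\mathcal G_1,\mathcal G_2,\dots$ (last index of each with first index of the next), where the first and last TT-ranks equal 1. The unfolded core is $U_i=\mathrm{reshape}(\mathcal G_i,[r_{i-1}n_i,r_i])$, so $\mathcal G_i=\mathrm{reshape}(U_i,[r_{i-1},n_i,r_i])$. Stream and accumulation. At increment $\ell$ a tensor $\mathcal Y^\ell\in\mathbb R^{n_1\times\cdots\times n_d\times n_{d+1}^\ell}$ arrives ($n_{d+1}^\ell$ is the batch size). The accumulation $\mathcal X^k$ is the concatenation of $\mathcal Y^1,\dots,\mathcal Y^k$ along the last dimension, with last dimension $N_k=\sum_{\ell\le k}n_{d+1}^\ell$. Its approximation $\hat{\mathcal X}^k$ is given in TT-format by $d+1$ cores with TT-ranks $r_0^k=1,r_1^k,\dots,r_d^k,r_{d+1}^k=1$: unfolded cores $U_i^k\in\mathbb R^{r_{i-1}^kn_i\times r_i^k}$ with orthonormal columns for $i=1,\dots,d$,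 and a last core regarded as a matrix $U_{d+1}^k\in\mathbb R^{r_d^k\times N_k}$. Represented approximation of an individual stream element. The columns of the last core $U_{d+1}^k$ are grouped in consecutive blocks, the $\ell$-th block consisting of the $n_{d+1}^\ell$ columns (in positions $N_{\ell-1}+1,\dots,N_\ell$, with $N_0=0$) corresponding to $\mathcal Y^\ell$. The approximation $\hat{\mathcal Y}^\ell$ represented by the cores $\{U_i^k\}_{i=1}^{d+1}$ is the contraction of $\mathcal G_1^k,\dots,\mathcal G_d^k$ with this block of columns; likewise for the cores $\{U_i^{k+1}\}_{i=1}^{d+1}$, using the same column positions in $U_{d+1}^{k+1}$. Truncated SVD. For a matrix $R$ and $\epsilon\ge0$, $\mathrm{SVD}(R,\epsilon)$ computes the truncated singular value decomposition $R=U_RV_R+E$, where $U_R$ consists of the left singular vectors for the $r_R$ largest singular values, $V_R$ is the product of the corresponding diagonal singular value matrix and the right singular vectors (as rows), and $r_R$ is the smallest rank such that $\|E\|_F\le\epsilon$ (possibly $r_R=0$, in which case $U_R$ is empty). TT-ICE algorithm. Input: $\{U_i^k\}_{i=1}^{d+1}$, $\mathcal Y^{k+1}$, tolerances $\epsilon_1,\dots,\epsilon_d$. Set $r_0^{k+1}=1$, $Y_1=\mathrm{reshape}(\mathcal Y^{k+1},[n_1,n_2\cdots n_dn_{d+1}^{k+1}])$ and $U_1^{k,\mathrm{pad}}=U_1^k$. For $i=1,\dots,d$: 1. $R_i^k=(I-U_i^{k,\mathrm{pad}}(U_i^{k,\mathrm{pad}})^T)Y_i$. 2. Compute $\mathrm{SVD}(R_i^k,\epsilon_i)$,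 giving left singular vectors $U_{R_i}^k$ and rank $r_{R_i}$. 3. $U_i^{k+1}=[\,U_i^{k,\mathrm{pad}}\ \ U_{R_i}^k\,]$ and $r_i^{k+1}=r_i^k+r_{R_i}$. 4. Zero-pad the next core. If $i<d$: append $r_{R_i}$ zero rows below $\mathrm{reshape}(U_{i+1}^k,[r_i^k,n_{i+1}r_{i+1}^k])$ and reshape the result to size $[r_i^{k+1}n_{i+1},r_{i+1}^k]$; call it $U_{i+1}^{k,\mathrm{pad}}$. If $i=d$: $U_{d+1}^{k,\mathrm{pad}}$ is $U_{d+1}^k$ with $r_{R_d}$ zero rows appended below. 5. If $i<d$: $Y_{i+1}=\mathrm{reshape}((U_i^{k+1})^TY_i,[r_i^{k+1}n_{i+1},n_{i+2}\cdots n_dn_{d+1}^{k+1}])$. If $i=d$: $Y_{d+1}=(U_d^{k+1})^TY_d\in\mathbb R^{r_d^{k+1}\times n_{d+1}^{k+1}}$. Finally set $U_{d+1}^{k+1}=[\,U_{d+1}^{k,\mathrm{pad}}\ \ Y_{d+1}\,]$. Output: $\{U_i^{k+1}\}_{i=1}^{d+1}$, with cores $\mathcal G_i^{k+1}=\mathrm{reshape}(U_i^{k+1},[r_{i-1}^{k+1},n_i,r_i^{k+1}])$ for $i\le d$; these represent $\hat{\mathcal X}^{k+1}$. *)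

theory Defs
  imports Complex_Main "Jordan_Normal_Form.Matrix"
begin

text \<open>A tensor is given by its shape and its entries. Multi-indices are 0-based; only the
  entries at multi-indices within the shape are meaningful. Matrices are those of
  \<^theory>\<open>Jordan_Normal_Form.Matrix\<close>, whose sizes are also values and may be 0.\<close>

datatype tensor = Tensor (dims: "nat list") (entry: "nat list \<Rightarrow> real")

definition indices :: "nat list \<Rightarrow> nat list set" where
  "indices ns = {is. list_all2 (<) is ns}"

definition frob :: "tensor \<Rightarrow> real" where
  "frob T = sqrt (\<Sum>is\<in>indices (dims T). (entry T is)\<^sup>2)"

definition tensor_diff :: "tensor \<Rightarrow> tensor \<Rightarrow> tensor" where
  "tensor_diff S T = Tensor (dims S) (\<lambda>is. entry S is - entry T is)"

definition tensor_of_mat :: "real mat \<Rightarrow> tensor" where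
  "tensor_of_mat A = Tensor [dim_row A, dim_col A] (\<lambda>is. A $$ (is ! 0, is ! 1))"

definition mat_of_tensor :: "tensor \<Rightarrow> real mat" where
  "mat_of_tensor T = mat (dims T ! 0) (dims T ! 1) (\<lambda>(i, j). entry T [i, j])"

text \<open>Column-major linearization of multi-indices (the first index varies fastest) and its
  inverse.\<close>

fun lin_index :: "nat list \<Rightarrow> nat list \<Rightarrow> nat" where
  "lin_index (n # ns) (i # is) = i + n * lin_index ns is"
| "lin_index _ _ = 0"

fun multi_index :: "nat list \<Rightarrow> nat \<Rightarrow> nat list" where
  "multi_index [] p = []"
| "multi_index (n # ns) p = (p mod n) # multi_index ns (p div n)"

text \<open>Reshaping is meaningful when the old and the new shape have the same number of entries.\<close>

definition reshape :: "tensor \<Rightarrow> nat list \<Rightarrow> tensor" where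
  "reshape T ns = Tensor ns (\<lambda>is. entry T (multi_index (dims T) (lin_index ns is)))"

definition reshape_mat :: "real mat \<Rightarrow> nat \<Rightarrow> nat \<Rightarrow> real mat" where
  "reshape_mat A p q = mat_of_tensor (reshape (tensor_of_mat A) [p, q])"

definition contract :: "tensor \<Rightarrow> tensor \<Rightarrow> tensor" where
  "contract A B = Tensor (butlast (dims A) @ tl (dims B))
     (\<lambda>is. let p = length (dims A) - 1 in
        \<Sum>s<hd (dims B). entry A (take p is @ [s]) * entry B (s # drop p is))"

definition contract_list :: "tensor list \<Rightarrow> tensor" where
  "contract_list Gs = foldl contract (hd Gs) (tl Gs)"

definition append_cols :: "real mat \<Rightarrow> real mat \<Rightarrow> real mat" where
  "append_cols A B = four_block_mat A B (0\<^sub>m 0 (dim_col A)) (0\<^sub>m 0 (dim_col B))"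

definition orthonormal_cols :: "real mat \<Rightarrow> bool" where
  "orthonormal_cols A \<longleftrightarrow> transpose_mat A * A = 1\<^sub>m (dim_col A)"

text \<open>\<open>is_svd R P s Q\<close>: \<open>R = P \<Sigma> Q\<^sup>T\<close> is a (full) singular value decomposition, with the
  singular values \<open>s 0 \<ge> s 1 \<ge> \<dots>\<close> on the diagonal of \<open>\<Sigma>\<close>.\<close>

definition is_svd :: "real mat \<Rightarrow> real mat \<Rightarrow> (nat \<Rightarrow> real) \<Rightarrow> real mat \<Rightarrow> bool" where
  "is_svd R P s Q \<longleftrightarrow>
     P \<in> carrier_mat (dim_row R) (dim_row R) \<and> orthonormal_cols P \<and>
     Q \<in> carrier_mat (dim_col R) (dim_col R) \<and> orthonormal_cols Q \<and>
     (\<forall>j < min (dim_row R) (dim_col R). 0 \<le> s j) \<and>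
     (\<forall>i j. i \<le> j \<and> j < min (dim_row R) (dim_col R) \<longrightarrow> s j \<le> s i) \<and>
     R = P * mat (dim_row R) (dim_col R) (\<lambda>(i, j). if i = j then s i else 0) * transpose_mat Q"

definition leading_left :: "real mat \<Rightarrow> nat \<Rightarrow> real mat" where
  "leading_left P \<rho> = mat (dim_row P) \<rho> (\<lambda>(i, j). P $$ (i, j))"

definition leading_right :: "(nat \<Rightarrow> real) \<Rightarrow> real mat \<Rightarrow> nat \<Rightarrow> real mat" where
  "leading_right s Q \<rho> = mat \<rho> (dim_row Q) (\<lambda>(i, j). s i * Q $$ (j, i))"

text \<open>An SVD is not unique, so the truncated SVD with tolerance \<open>\<epsilon>\<close> is a relation: \<open>UR\<close> and \<open>VR\<close>
  may stem from any singular value decomposition of \<open>R\<close>.\<close>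

definition truncated_svd :: "real mat \<Rightarrow> real \<Rightarrow> real mat \<Rightarrow> real mat \<Rightarrow> bool" where
  "truncated_svd R \<epsilon> UR VR \<longleftrightarrow>
     (\<exists>P s Q \<rho>. is_svd R P s Q \<and>
        \<rho> \<le> min (dim_row R) (dim_col R) \<and>
        frob (tensor_of_mat (R - leading_left P \<rho> * leading_right s Q \<rho>)) \<le> \<epsilon> \<and>
        (\<forall>\<rho>' < \<rho>. \<not> frob (tensor_of_mat (R - leading_left P \<rho>' * leading_right s Q \<rho>')) \<le> \<epsilon>) \<and>
        UR = leading_left P \<rho> \<and> VR = leading_right s Q \<rho>)"

text \<open>In the following, \<open>n i\<close> is the size of the \<open>i\<close>-th mode (\<open>1 \<le> i \<le> d\<close>), \<open>b l\<close> is the batch size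
  of the \<open>l\<close>-th increment (\<open>l \<ge> 1\<close>), and unfolded cores are families \<open>U 1, \<dots>, U (d + 1)\<close> of matrices
  with TT-ranks \<open>r 0, \<dots>, r d\<close>. The last core is regarded as a matrix of size \<open>r d \<times> N\<close>, which
  accounts for \<open>r (d + 1) = 1\<close>.\<close>

definition stream_shape :: "nat \<Rightarrow> (nat \<Rightarrow> nat) \<Rightarrow> nat \<Rightarrow> nat list" where
  "stream_shape d n m = map n [1..<Suc d] @ [m]"

definition acc_size :: "(nat \<Rightarrow> nat) \<Rightarrow> nat \<Rightarrow> nat" where
  "acc_size b k = (\<Sum>l = 1..k. b l)"

definition tt_cores ::
  "nat \<Rightarrow> (nat \<Rightarrow> nat) \<Rightarrow> (nat \<Rightarrow> nat) \<Rightarrow> nat \<Rightarrow> (nat \<Rightarrow> real mat) \<Rightarrow> bool" where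
  "tt_cores d n r N U \<longleftrightarrow>
     r 0 = 1 \<and>
     (\<forall>i\<in>{1..d}. U i \<in> carrier_mat (r (i - 1) * n i) (r i) \<and> orthonormal_cols (U i)) \<and>
     U (d + 1) \<in> carrier_mat (r d) N"

definition core :: "(nat \<Rightarrow> nat) \<Rightarrow> (nat \<Rightarrow> nat) \<Rightarrow> (nat \<Rightarrow> real mat) \<Rightarrow> nat \<Rightarrow> tensor" where
  "core n r U i = reshape (tensor_of_mat (U i)) [r (i - 1), n i, r i]"

definition column_block :: "(nat \<Rightarrow> nat) \<Rightarrow> real mat \<Rightarrow> nat \<Rightarrow> real mat" where
  "column_block b A l = mat (dim_row A) (b l) (\<lambda>(i, j). A $$ (i, acc_size b (l - 1) + j))"

text \<open>The contraction of the cores with a block of columns has shape \<open>1 \<times> n 1 \<times> \<dots> \<times> n d \<times> b l\<close>,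
  since \<open>r 0 = 1\<close>; the outer \<open>reshape\<close> only drops the leading singleton mode.\<close>

definition represented ::
  "nat \<Rightarrow> (nat \<Rightarrow> nat) \<Rightarrow> (nat \<Rightarrow> nat) \<Rightarrow> (nat \<Rightarrow> nat) \<Rightarrow> (nat \<Rightarrow> real mat) \<Rightarrow> nat \<Rightarrow> tensor" where
  "represented d n b r U l =
     reshape (contract_list
                (map (core n r U) [1..<Suc d] @ [tensor_of_mat (column_block b (U (d + 1)) l)]))
       (stream_shape d n (b l))"

text \<open>\<open>tt_ice d n m r U Ynew \<epsilon>s r' U'\<close>: one run of TT-ICE on the cores \<open>U\<close> (with ranks \<open>r\<close>), the new
  tensor \<open>Ynew\<close> of batch size \<open>m\<close> and the tolerances \<open>\<epsilon>s 1, \<dots>, \<epsilon>s d\<close> may return the cores \<open>U'\<close> with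
  ranks \<open>r'\<close>. It is a relation because of the choices made in the truncated SVDs.\<close>

definition tt_ice ::
  "nat \<Rightarrow> (nat \<Rightarrow> nat) \<Rightarrow> nat \<Rightarrow> (nat \<Rightarrow> nat) \<Rightarrow> (nat \<Rightarrow> real mat) \<Rightarrow> tensor \<Rightarrow> (nat \<Rightarrow> real) \<Rightarrow>
   (nat \<Rightarrow> nat) \<Rightarrow> (nat \<Rightarrow> real mat) \<Rightarrow> bool" where
  "tt_ice d n m r U Ynew \<epsilon>s r' U' \<longleftrightarrow>
     (\<exists>Upad Y R UR VR.
        r' 0 = 1 \<and>
        Y 1 = mat_of_tensor (reshape Ynew [n 1, (\<Prod>j = 2..d. n j) * m]) \<and>
        Upad 1 = U 1 \<and>
        (\<forall>i\<in>{1..d}.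
           R i = (1\<^sub>m (dim_row (Upad i)) - Upad i * transpose_mat (Upad i)) * Y i \<and>
           truncated_svd (R i) (\<epsilon>s i) (UR i) (VR i) \<and>
           U' i = append_cols (Upad i) (UR i) \<and>
           r' i = r i + dim_col (UR i) \<and>
           (i < d \<longrightarrow>
              Upad (i + 1) =
                reshape_mat
                  (reshape_mat (U (i + 1)) (r i) (n (i + 1) * r (i + 1))
                     @\<^sub>r 0\<^sub>m (dim_col (UR i)) (n (i + 1) * r (i + 1)))
                  (r' i * n (i + 1)) (r (i + 1)) \<and>
              Y (i + 1) =
                reshape_mat (transpose_mat (U' i) * Y i)
                  (r' i * n (i + 1)) ((\<Prod>j = i + 2..d. n j) * m)) \<and>
           (i = d \<longrightarrow>
              Upad (d + 1) = U (d + 1) @\<^sub>r 0\<^sub>m (dim_col (UR d)) (dim_col (U (d + 1))) \<and>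
              Y (d + 1) = transpose_mat (U' d) * Y d)) \<and>
        U' (d + 1) = append_cols (Upad (d + 1)) (Y (d + 1)))"

end

theory Submission
  imports Defs
begin

text \<open>
  TT-ICE only ever enlarges what the cores span, and it never changes what was represented before.
  Every update of a core appends columns on the right, and every slice that pairs with a newly
  created rank index is padded with zeros. In the contraction over an enlarged rank, each new
  index therefore meets a zero of the next core, as long as only old columns of that next core are
  looked at; the old indices contribute exactly the old terms. By induction on the number of
  contracted cores, the entries of the partial contractions at old final rank indices agree with
  those before the update. The last contraction is of the same kind, because the columns belonging
  to the earlier tensors are old columns padded with zero rows. So the represented approximation
  of each earlier tensor is entrywise the same tensor as before, and its error bound is inherited.
  The lemma for a single contraction is \<open>contract_zero_padding\<close>, its iteration is
  \<open>contract_list_cores_zero_padding\<close>.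

  That the new cores are again admissible needs the columns of \<open>[Upad UR]\<close> to be orthonormal.
  Interleaving zero rows does not affect inner products of columns (\<open>orthonormal_zero_pad\<close>). The
  columns of \<open>UR\<close> are orthogonal to \<open>Upad\<close> because they lie in the column space of the residual
  \<open>(I - Upad Upad\<^sup>T) Y\<close>. This uses the minimality of the truncation rank: left singular vectors
  for the singular value zero need not lie in that column space, but a minimal truncation never
  retains them (\<open>truncated_svd_left_factor\<close>).
\<close>

section \<open>Indices and reshaping\<close>

lemma length_indices: "is \<in> indices ns \<Longrightarrow> length is = length ns"
  by (auto simp: indices_def dest: list_all2_lengthD)

lemma multi_index_lin_index: "is \<in> indices ns \<Longrightarrow> multi_index ns (lin_index ns is) = is"
  unfolding indices_def mem_Collect_eq by (induction rule: list_all2_induct) auto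

lemma dim_reshape_mat [simp]:
  "dim_row (reshape_mat A p q) = p" "dim_col (reshape_mat A p q) = q"
  by (simp_all add: reshape_mat_def mat_of_tensor_def reshape_def)

lemma index_reshape_mat:
  assumes "i < p" "j < q"
  shows "reshape_mat A p q $$ (i, j) =
    A $$ ((i + p * j) mod dim_row A, (i + p * j) div dim_row A mod dim_col A)"
  using assms by (simp add: reshape_mat_def mat_of_tensor_def reshape_def tensor_of_mat_def)

lemma less_mult_add:
  fixes s p x n :: nat
  assumes "s < p" "x < n"
  shows "s + p * x < p * n"
proof -
  have "s + p * x < p * Suc x" using assms by simp
  also have "\<dots> \<le> p * n" using assms by (intro mult_le_mono2) simp
  finally show ?thesis .
qed

text \<open>An entry of a three-way array has one linear position, read off once with the first two modes
  merged and once with the last two modes merged. The position is written in two ways, each being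
  the one in which reshaping between the two unfoldings produces it.\<close>

lemma mixed_radix:
  fixes s p x n t q :: nat
  assumes "s < p" "x < n" "t < q"
  shows "(s + p * (x + n * t)) mod (p * n) = s + p * x"
    "(s + p * (x + n * t)) div (p * n) mod q = t"
    "(s + p * x + p * n * t) mod p = s"
    "(s + p * x + p * n * t) div p mod (n * q) = x + n * t"
proof -
  note sx = less_mult_add[OF assms(1,2)]
  have pn: "0 < p * n" using sx by linarith
  have eq: "s + p * (x + n * t) = s + p * x + p * n * t"
    by (simp add: algebra_simps)
  show "(s + p * (x + n * t)) mod (p * n) = s + p * x"
    unfolding eq using sx by simp
  have "(s + p * x + p * n * t) div (p * n) = t"
    using sx pn by (subst div_mult_self2) auto
  then show "(s + p * (x + n * t)) div (p * n) mod q = t"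
    unfolding eq using assms(3) by simp
  show "(s + p * x + p * n * t) mod p = s"
    unfolding eq[symmetric] using assms(1) by simp
  have "(s + p * (x + n * t)) div p = x + n * t"
    using assms(1) by (subst div_mult_self2) auto
  then show "(s + p * x + p * n * t) div p mod (n * q) = x + n * t"
    unfolding eq[symmetric] using less_mult_add[OF assms(2,3)] by simp
qed

lemma index_reshape_mat_split:
  assumes "A \<in> carrier_mat (p * n) q" "s < p" "x < n" "t < q"
  shows "reshape_mat A p (n * q) $$ (s, x + n * t) = A $$ (s + p * x, t)"
  using assms(1) mixed_radix[OF assms(2-4)]
  by (subst index_reshape_mat) (use assms less_mult_add[OF assms(3,4)] in auto)

lemma index_reshape_mat_merge:
  assumes "A \<in> carrier_mat p (n * q)" "s < p" "x < n" "t < q"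
  shows "reshape_mat A (p * n) q $$ (s + p * x, t) = A $$ (s, x + n * t)"
  using assms(1) mixed_radix[OF assms(2-4)]
  by (subst index_reshape_mat) (use assms less_mult_add[OF assms(2,3)] in auto)

lemma dims_core [simp]: "dims (core n r U i) = [r (i - 1), n i, r i]"
  by (simp add: core_def reshape_def)

lemma entry_core:
  assumes "U i \<in> carrier_mat (r (i - 1) * n i) (r i)" "s < r (i - 1)" "x < n i" "t < r i"
  shows "entry (core n r U i) [s, x, t] = U i $$ (s + r (i - 1) * x, t)"
  using assms(1) mixed_radix[OF assms(2-4)]
  by (simp add: core_def reshape_def tensor_of_mat_def)

section \<open>Appending columns\<close>

lemma append_cols_carrier:
  assumes "A \<in> carrier_mat m p" "B \<in> carrier_mat m q"
  shows "append_cols A B \<in> carrier_mat m (p + q)"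
  using assms by (auto simp: append_cols_def)

lemma index_append_cols:
  assumes "A \<in> carrier_mat m p" "B \<in> carrier_mat m q" "i < m" "j < p + q"
  shows "append_cols A B $$ (i, j) = (if j < p then A $$ (i, j) else B $$ (i, j - p))"
  using assms by (auto simp: append_cols_def)

lemma index_transpose_mult:
  assumes "A \<in> carrier_mat m p" "B \<in> carrier_mat m q" "i < p" "j < q"
  shows "(transpose_mat A * B) $$ (i, j) = (\<Sum>x<m. A $$ (x, i) * B $$ (x, j))"
  using assms by (auto simp: scalar_prod_def atLeast0LessThan intro!: sum.cong)

lemma orthonormal_cols_iff:
  assumes "A \<in> carrier_mat m p"
  shows "orthonormal_cols A \<longleftrightarrow>
    (\<forall>i<p. \<forall>j<p. (\<Sum>x<m. A $$ (x, i) * A $$ (x, j)) = (if i = j then 1 else 0))"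
  using assms index_transpose_mult[OF assms assms] unfolding orthonormal_cols_def
  by (auto simp: mat_eq_iff)

lemma orthonormal_append_cols:
  assumes A: "A \<in> carrier_mat m p" and B: "B \<in> carrier_mat m q"
    and "orthonormal_cols A" "orthonormal_cols B"
    and AB: "transpose_mat A * B = 0\<^sub>m p q"
  shows "orthonormal_cols (append_cols A B)"
proof -
  have cross: "(\<Sum>x<m. A $$ (x, i) * B $$ (x, j)) = 0" if "i < p" "j < q" for i j
    using index_transpose_mult[OF A B that] that by (simp add: AB)
  have cross': "(\<Sum>x<m. B $$ (x, j) * A $$ (x, i)) = 0" if "i < p" "j < q" for i j
    using cross[OF that] by (simp add: mult.commute)
  have ix: "append_cols A B $$ (x, i) = (if i < p then A $$ (x, i) else B $$ (x, i - p))"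
    if "x < m" "i < p + q" for x i
    using index_append_cols[OF A B that] .
  show ?thesis
    unfolding orthonormal_cols_iff[OF append_cols_carrier[OF A B]]
  proof (intro allI impI)
    fix i j assume ij: "i < p + q" "j < p + q"
    then show "(\<Sum>x<m. append_cols A B $$ (x, i) * append_cols A B $$ (x, j)) =
        (if i = j then 1 else 0)"
      using assms(3,4) cross[of i "j - p"] cross'[of j "i - p"]
      unfolding orthonormal_cols_iff[OF A] orthonormal_cols_iff[OF B]
      by (cases "i < p"; cases "j < p") (auto simp: ix)
  qed
qed

section \<open>Truncated singular value decompositions\<close>

lemma index_leading_mult:
  assumes "i < dim_row P" "j < dim_row Q"
  shows "(leading_left P \<rho> * leading_right s Q \<rho>) $$ (i, j) =
    (\<Sum>x<\<rho>. P $$ (i, x) * (s x * Q $$ (j, x)))"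
  using assms
  by (auto simp: leading_left_def leading_right_def scalar_prod_def atLeast0LessThan
      intro!: sum.cong)

text \<open>Whatever annihilates \<open>R\<close> from the left annihilates the retained left singular vectors:
  \<open>W R = 0\<close> gives \<open>W P \<Sigma> = 0\<close>, so the \<open>j\<close>-th column of \<open>W P\<close> vanishes whenever the \<open>j\<close>-th singular value
  is nonzero, and the minimality of the rank excludes vanishing ones.\<close>

lemma truncated_svd_left_factor:
  assumes svd: "truncated_svd R \<epsilon> UR VR"
    and W: "W \<in> carrier_mat m (dim_row R)" and WR: "W * R = 0\<^sub>m m (dim_col R)"
  shows "UR \<in> carrier_mat (dim_row R) (dim_col UR)" "orthonormal_cols UR"
    "W * UR = 0\<^sub>m m (dim_col UR)"
proof -
  obtain P s Q \<rho> where
    svdR: "is_svd R P s Q" and \<rho>: "\<rho> \<le> min (dim_row R) (dim_col R)"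
    and err: "frob (tensor_of_mat (R - leading_left P \<rho> * leading_right s Q \<rho>)) \<le> \<epsilon>"
    and least: "\<forall>\<rho>'<\<rho>. \<not> frob (tensor_of_mat (R - leading_left P \<rho>' * leading_right s Q \<rho>')) \<le> \<epsilon>"
    and UR: "UR = leading_left P \<rho>"
    using svd unfolding truncated_svd_def by blast
  define \<Sigma> where "\<Sigma> = mat (dim_row R) (dim_col R) (\<lambda>(i, j). if i = j then s i else 0 :: real)"
  have P: "P \<in> carrier_mat (dim_row R) (dim_row R)" and oP: "orthonormal_cols P"
    and Q: "Q \<in> carrier_mat (dim_col R) (dim_col R)" and oQ: "orthonormal_cols Q"
    and nonneg: "\<And>j. j < min (dim_row R) (dim_col R) \<Longrightarrow> 0 \<le> s j"
    and decr: "\<And>i j. i \<le> j \<Longrightarrow> j < min (dim_row R) (dim_col R) \<Longrightarrow> s j \<le> s i"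
    and R: "R = P * \<Sigma> * transpose_mat Q"
    using svdR unfolding is_svd_def \<Sigma>_def by blast+
  have \<Sigma>: "\<Sigma> \<in> carrier_mat (dim_row R) (dim_col R)" by (simp add: \<Sigma>_def)
  \<comment> \<open>If a retained singular value vanished, so would all later ones; stopping at that value
    would then give the same product, contradicting minimality of the rank.\<close>
  have pos: "s j \<noteq> 0" if j: "j < \<rho>" for j
  proof
    assume 0: "s j = 0"
    have zero: "s x = 0" if "x \<in> {..<\<rho>} - {..<j}" for x
      using decr[of j x] nonneg[of x] that 0 \<rho> by auto
    have "leading_left P \<rho> * leading_right s Q \<rho> = leading_left P j * leading_right s Q j"
    proof (rule eq_matI)
      fix a c
      assume "a < dim_row (leading_left P j * leading_right s Q j)"
        and "c < dim_col (leading_left P j * leading_right s Q j)"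
      then have ac: "a < dim_row P" "c < dim_row Q"
        by (auto simp: leading_left_def leading_right_def)
      show "(leading_left P \<rho> * leading_right s Q \<rho>) $$ (a, c) =
          (leading_left P j * leading_right s Q j) $$ (a, c)"
        unfolding index_leading_mult[OF ac]
        by (rule sum.mono_neutral_right) (use j zero in auto)
    qed (auto simp: leading_left_def leading_right_def)
    with err least j show False by simp
  qed
  show "UR \<in> carrier_mat (dim_row R) (dim_col UR)"
    using P by (simp add: UR leading_left_def)
  have dc: "dim_col UR = \<rho>" by (simp add: UR leading_left_def)
  have URc: "UR \<in> carrier_mat (dim_row R) \<rho>" using P by (simp add: UR leading_left_def)
  have URix: "UR $$ (i, j) = P $$ (i, j)" if "i < dim_row R" "j < \<rho>" for i j
    using that P by (simp add: UR leading_left_def)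
  show "orthonormal_cols UR"
    using oP \<rho> unfolding orthonormal_cols_iff[OF URc] orthonormal_cols_iff[OF P]
    by (auto simp: URix)
  have WP: "W * P \<in> carrier_mat m (dim_row R)" using W P by simp
  have Qt: "transpose_mat Q \<in> carrier_mat (dim_col R) (dim_col R)" using Q by simp
  have "R * Q = P * \<Sigma> * (transpose_mat Q * Q)"
    using assoc_mult_mat[OF mult_carrier_mat[OF P \<Sigma>] Qt Q] R by simp
  also have "\<dots> = P * \<Sigma>"
    using oQ Q right_mult_one_mat[OF mult_carrier_mat[OF P \<Sigma>]] by (simp add: orthonormal_cols_def)
  finally have RQ: "R * Q = P * \<Sigma>" .
  have "W * P * \<Sigma> = W * (R * Q)"
    using assoc_mult_mat[OF W P \<Sigma>] RQ by simp
  also have "\<dots> = W * R * Q"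
    using assoc_mult_mat[OF W _ Q, of R] by auto
  also have "\<dots> = 0\<^sub>m m (dim_col R)"
    using Q by (simp add: WR)
  finally have WPS: "W * P * \<Sigma> = 0\<^sub>m m (dim_col R)" .
  have orth: "(W * P) $$ (a, j) = 0" if a: "a < m" and j: "j < \<rho>" for a j
  proof -
    have jb: "j < dim_row R" "j < dim_col R" using j \<rho> by auto
    have "(W * P * \<Sigma>) $$ (a, j) = (\<Sum>x<dim_row R. (W * P) $$ (a, x) * (if x = j then s x else 0))"
      using WP \<Sigma> a jb W P
      by (auto simp: scalar_prod_def \<Sigma>_def atLeast0LessThan intro!: sum.cong)
    also have "\<dots> = (\<Sum>x<dim_row R. if x = j then (W * P) $$ (a, j) * s j else 0)"
      by (rule sum.cong) auto
    also have "\<dots> = (W * P) $$ (a, j) * s j"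
      using jb by simp
    finally show ?thesis
      using WPS pos[OF j] a jb by simp
  qed
  show "W * UR = 0\<^sub>m m (dim_col UR)"
  proof (rule eq_matI)
    fix a j assume "a < dim_row (0\<^sub>m m (dim_col UR) :: real mat)" "j < dim_col (0\<^sub>m m (dim_col UR) :: real mat)"
    then have aj: "a < m" "j < \<rho>" by (auto simp: dc)
    have "(W * UR) $$ (a, j) = (W * P) $$ (a, j)"
      using aj W P URc \<rho> by (auto simp: scalar_prod_def URix intro!: sum.cong)
    then show "(W * UR) $$ (a, j) = 0\<^sub>m m (dim_col UR) $$ (a, j)"
      using orth[OF aj] aj by (simp add: dc)
  qed (use W URc dc in auto)
qed

lemma transpose_mult_complement:
  fixes A Y :: "real mat"
  assumes A: "A \<in> carrier_mat m p" and "orthonormal_cols A" and Y: "Y \<in> carrier_mat m q"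
  shows "transpose_mat A * ((1\<^sub>m m - A * transpose_mat A) * Y) = 0\<^sub>m p q"
proof -
  have At: "transpose_mat A \<in> carrier_mat p m" using A by simp
  have AA: "A * transpose_mat A \<in> carrier_mat m m" using A by simp
  have C: "1\<^sub>m m - A * transpose_mat A \<in> carrier_mat m m"
    using minus_carrier_mat[OF AA] .
  have "transpose_mat A * (A * transpose_mat A) = transpose_mat A * A * transpose_mat A"
    by (rule assoc_mult_mat[OF At A At, symmetric])
  also have "\<dots> = transpose_mat A"
    using assms(2) A left_mult_one_mat[OF At] unfolding orthonormal_cols_def by simp
  finally have AtAA: "transpose_mat A * (A * transpose_mat A) = transpose_mat A" .
  have "transpose_mat A * (1\<^sub>m m - A * transpose_mat A) = transpose_mat A - transpose_mat A"
    unfolding mult_minus_distrib_mat[OF At one_carrier_mat AA] AtAA right_mult_one_mat[OF At] ..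
  also have "\<dots> = 0\<^sub>m p m"
    using minus_r_inv_mat[OF At] .
  finally have "transpose_mat A * (1\<^sub>m m - A * transpose_mat A) * Y = 0\<^sub>m p q"
    using left_mult_zero_mat[OF Y] by simp
  then show ?thesis
    unfolding assoc_mult_mat[OF At C Y] .
qed

lemma orthonormal_append_residual:
  assumes A: "A \<in> carrier_mat m p" and oA: "orthonormal_cols A" and Y: "Y \<in> carrier_mat m q"
    and svd: "truncated_svd ((1\<^sub>m m - A * transpose_mat A) * Y) \<epsilon> UR VR"
  shows "UR \<in> carrier_mat m (dim_col UR)" "orthonormal_cols (append_cols A UR)"
proof -
  let ?R = "(1\<^sub>m m - A * transpose_mat A) * Y"
  have dims: "dim_row ?R = m" "dim_col ?R = q" using A Y by auto
  have W: "transpose_mat A \<in> carrier_mat p (dim_row ?R)"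
    unfolding dims using A by simp
  have WR: "transpose_mat A * ?R = 0\<^sub>m p (dim_col ?R)"
    unfolding dims by (rule transpose_mult_complement[OF A oA Y])
  note UR = truncated_svd_left_factor[OF svd W WR]
  show c: "UR \<in> carrier_mat m (dim_col UR)" using UR(1) unfolding dims .
  show "orthonormal_cols (append_cols A UR)"
    by (rule orthonormal_append_cols[OF A c oA UR(2,3)])
qed

section \<open>Zero-padded cores\<close>

text \<open>\<open>A\<close> is the unfolding of a core of size \<open>\<rho> \<times> n \<times> q\<close>; its first mode is enlarged by \<open>z\<close> zero slices.
  In the unfolding these zero rows are interleaved: \<open>z\<close> of them follow each group of \<open>\<rho>\<close> rows.\<close>

definition zero_pad :: "real mat \<Rightarrow> nat \<Rightarrow> nat \<Rightarrow> nat \<Rightarrow> nat \<Rightarrow> real mat" where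
  "zero_pad A \<rho> z n q =
     reshape_mat (reshape_mat A \<rho> (n * q) @\<^sub>r 0\<^sub>m z (n * q)) ((\<rho> + z) * n) q"

lemma index_append_zero_rows:
  assumes "A \<in> carrier_mat \<rho> q" "i < \<rho> + z" "j < q"
  shows "(A @\<^sub>r 0\<^sub>m z q) $$ (i, j) = (if i < \<rho> then A $$ (i, j) else 0)"
  using assms by (auto simp: append_rows_def)

lemma zero_pad_carrier: "zero_pad A \<rho> z n q \<in> carrier_mat ((\<rho> + z) * n) q"
  by (auto simp: zero_pad_def)

lemma index_zero_pad:
  assumes A: "A \<in> carrier_mat (\<rho> * n) q" and "s < \<rho> + z" "x < n" "t < q"
  shows "zero_pad A \<rho> z n q $$ (s + (\<rho> + z) * x, t) =
    (if s < \<rho> then A $$ (s + \<rho> * x, t) else 0)"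
proof -
  have B: "reshape_mat A \<rho> (n * q) \<in> carrier_mat \<rho> (n * q)"
    by auto
  have "zero_pad A \<rho> z n q $$ (s + (\<rho> + z) * x, t) =
      (reshape_mat A \<rho> (n * q) @\<^sub>r 0\<^sub>m z (n * q)) $$ (s, x + n * t)"
    unfolding zero_pad_def
    by (rule index_reshape_mat_merge) (use assms B in auto)
  also have "\<dots> = (if s < \<rho> then reshape_mat A \<rho> (n * q) $$ (s, x + n * t) else 0)"
    by (rule index_append_zero_rows[OF B]) (use assms less_mult_add in auto)
  also have "\<dots> = (if s < \<rho> then A $$ (s + \<rho> * x, t) else 0)"
    using index_reshape_mat_split[OF A] assms by simp
  finally show ?thesis .
qed

lemma sum_lessThan_mult:
  "(\<Sum>y<p * n. f y) = (\<Sum>x<n. \<Sum>s<p. f (s + p * x :: nat) :: real)"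
proof (induction n)
  case (Suc n)
  have "(\<Sum>y<p * Suc n. f y) = (\<Sum>y<p * n. f y) + (\<Sum>y=p * n..<p * n + p. f y)"
    by (simp add: lessThan_atLeast0 sum.atLeastLessThan_concat add.commute)
  also have "(\<Sum>y=p * n..<p * n + p. f y) = (\<Sum>s<p. f (s + p * n))"
    using sum.shift_bounds_nat_ivl[of f 0 "p * n" p]
    by (simp add: lessThan_atLeast0 add.commute)
  finally show ?case using Suc by simp
qed simp

lemma sum_zero_extend:
  fixes f g :: "nat \<Rightarrow> real"
  assumes "\<And>s. s < \<rho> \<Longrightarrow> g s = f s" "\<And>s. \<rho> \<le> s \<Longrightarrow> s < \<rho>' \<Longrightarrow> g s = 0" "\<rho> \<le> \<rho>'"
  shows "(\<Sum>s<\<rho>'. g s) = (\<Sum>s<\<rho>. f s)"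
proof -
  have "(\<Sum>s<\<rho>'. g s) = (\<Sum>s<\<rho>. g s)"
    by (rule sum.mono_neutral_right) (use assms in auto)
  also have "\<dots> = (\<Sum>s<\<rho>. f s)"
    by (rule sum.cong) (use assms in auto)
  finally show ?thesis .
qed

text \<open>Summing over the rows slice by slice, each inner product of two columns only acquires zero
  terms from the padding.\<close>

lemma orthonormal_zero_pad:
  assumes A: "A \<in> carrier_mat (\<rho> * n) q" and oA: "orthonormal_cols A"
  shows "orthonormal_cols (zero_pad A \<rho> z n q)"
proof -
  let ?Z = "zero_pad A \<rho> z n q"
  have "(\<Sum>y<(\<rho> + z) * n. ?Z $$ (y, i) * ?Z $$ (y, j)) = (\<Sum>y<\<rho> * n. A $$ (y, i) * A $$ (y, j))"
    if "i < q" "j < q" for i j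
    unfolding sum_lessThan_mult
    by (intro sum.cong[OF refl] sum_zero_extend) (use index_zero_pad[OF A] that in auto)
  then show ?thesis
    using oA unfolding orthonormal_cols_iff[OF A] orthonormal_cols_iff[OF zero_pad_carrier]
    by simp
qed

section \<open>Contractions\<close>

lemma contract_list_snoc: "Gs \<noteq> [] \<Longrightarrow> contract_list (Gs @ [G]) = contract (contract_list Gs) G"
  by (simp add: contract_list_def)

lemma dims_contract_list_cores:
  assumes "j \<ge> 1"
  shows "dims (contract_list (map (core n r U) [1..<Suc j])) = (r 0 # map n [1..<Suc j]) @ [r j]"
  using assms
proof (induction j rule: nat_induct_at_least)
  case base
  show ?case by (simp add: contract_list_def)
next
  case (Suc j)
  have "map (core n r U) [1..<Suc (Suc j)] = map (core n r U) [1..<Suc j] @ [core n r U (Suc j)]"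
    using Suc.hyps by simp
  then show ?case
    using Suc by (simp add: contract_list_snoc contract_def del: upt_Suc) simp
qed

text \<open>The extra values of the contracted index are harmless as soon as the right factor vanishes on
  them. Agreement is demanded and obtained only along
  fixed outer indices \<open>is\<close> and \<open>js\<close>, so that the result applies to the old columns of a core that also
  has new ones.\<close>

lemma contract_zero_padding:
  assumes A: "dims A = ns @ [\<rho>]" and A': "dims A' = ns @ [\<rho>']"
    and B: "dims B = \<rho> # ms" and B': "dims B' = \<rho>' # ms'" and le: "\<rho> \<le> \<rho>'"
    and len: "length is = length ns"
    and eqA: "\<And>s. s < \<rho> \<Longrightarrow> entry A' (is @ [s]) = entry A (is @ [s])"
    and eqB: "\<And>s. s < \<rho> \<Longrightarrow> entry B' (s # js) = entry B (s # js)"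
    and zero: "\<And>s. \<rho> \<le> s \<Longrightarrow> s < \<rho>' \<Longrightarrow> entry B' (s # js) = 0"
  shows "entry (contract A' B') (is @ js) = entry (contract A B) (is @ js)"
proof -
  have "(\<Sum>s<\<rho>'. entry A' (is @ [s]) * entry B' (s # js)) =
      (\<Sum>s<\<rho>. entry A (is @ [s]) * entry B (s # js))"
    by (rule sum_zero_extend) (use eqA eqB zero le in auto)
  then show ?thesis
    using len by (simp add: contract_def A A' B B')
qed

lemma indices_snocE:
  assumes "is \<in> indices (ns @ [m])"
  obtains js x where "is = js @ [x]" "js \<in> indices ns" "x < m"
  using assms by (auto simp: indices_def list_all2_append2 list_all2_Cons2)

text \<open>Agreement of the partial contractions can only hold for final rank indices \<open>t < r j\<close>: beyond them
  lie the contributions of appended columns. This suffices for the induction, since the next core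
  is zero at precisely those indices.\<close>

lemma contract_list_cores_zero_padding:
  assumes j: "1 \<le> j" "j \<le> d" and r0: "r' 0 = r 0" and le: "\<And>i. i \<in> {1..d} \<Longrightarrow> r i \<le> r' i"
    and eq: "\<And>i s x t. i \<in> {1..d} \<Longrightarrow> s < r (i - 1) \<Longrightarrow> x < n i \<Longrightarrow> t < r i \<Longrightarrow>
      entry (core n r' U' i) [s, x, t] = entry (core n r U i) [s, x, t]"
    and zero: "\<And>i s x t. i \<in> {1..d} \<Longrightarrow> r (i - 1) \<le> s \<Longrightarrow> s < r' (i - 1) \<Longrightarrow> x < n i \<Longrightarrow> t < r i \<Longrightarrow>
      entry (core n r' U' i) [s, x, t] = 0"
    and "is \<in> indices (r 0 # map n [1..<Suc j])" "t < r j"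
  shows "entry (contract_list (map (core n r' U') [1..<Suc j])) (is @ [t]) =
    entry (contract_list (map (core n r U) [1..<Suc j])) (is @ [t])"
  using j assms(7,8)
proof (induction j arbitrary: "is" t rule: nat_induct_at_least)
  case base
  from base(2) obtain s x where "is = [s, x]" "s < r 0" "x < n 1"
    by (auto simp: indices_def list_all2_Cons2)
  then show ?case
    using eq[of 1 s x t] base by (simp add: contract_list_def)
next
  case (Suc j)
  have split: "map f [1..<Suc (Suc j)] = map f [1..<Suc j] @ [f (Suc j)]" for f :: "nat \<Rightarrow> 'z"
    using Suc.hyps by simp
  have ne: "map (core n r U) [1..<Suc j] \<noteq> []" for r U
    using Suc.hyps by simp
  have "is \<in> indices ((r 0 # map n [1..<Suc j]) @ [n (Suc j)])"
    using Suc.prems(2) Suc.hyps by simp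
  then obtain js x where "is": "is = js @ [x]" and js: "js \<in> indices (r 0 # map n [1..<Suc j])"
    and x: "x < n (Suc j)"
    by (rule indices_snocE)
  have len: "length js = length (r 0 # map n [1..<Suc j])"
    by (rule length_indices[OF js])
  have dU: "dims (contract_list (map (core n r U) [1..<Suc j])) = (r 0 # map n [1..<Suc j]) @ [r j]"
    by (rule dims_contract_list_cores[OF Suc.hyps])
  have dU': "dims (contract_list (map (core n r' U') [1..<Suc j])) = (r 0 # map n [1..<Suc j]) @ [r' j]"
    using dims_contract_list_cores[OF Suc.hyps, of n r' U'] r0 by simp
  have "entry (contract (contract_list (map (core n r' U') [1..<Suc j])) (core n r' U' (Suc j))) (js @ [x, t]) =
      entry (contract (contract_list (map (core n r U) [1..<Suc j])) (core n r U (Suc j))) (js @ [x, t])"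
  proof (rule contract_zero_padding[OF dU dU' _ _ _ len])
    fix s assume "s < r j"
    then show "entry (contract_list (map (core n r' U') [1..<Suc j])) (js @ [s]) =
        entry (contract_list (map (core n r U) [1..<Suc j])) (js @ [s])"
      using Suc.IH js Suc.prems(1) by simp
  qed (use le[of j] eq[of "Suc j"] zero[of "Suc j"] Suc.prems Suc.hyps x in auto)
  then show ?case
    unfolding split contract_list_snoc[OF ne] "is" by simp
qed

section \<open>Updating the cores\<close>

lemma column_block_bound:
  assumes "l \<in> {1..k}" "j < b l"
  shows "acc_size b (l - 1) + j < acc_size b k"
proof -
  have l: "l = Suc (l - 1)" using assms(1) by simp
  have "acc_size b (l - 1) + b l = acc_size b l"
    unfolding acc_size_def by (subst (3) l, subst sum.nat_ivl_Suc') (use l in auto)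
  also have "\<dots> \<le> acc_size b k"
    unfolding acc_size_def by (rule sum_mono2) (use assms(1) in auto)
  finally show ?thesis using assms(2) by simp
qed


theorem theorem4:
  fixes d k :: nat
    and n b r r' :: "nat \<Rightarrow> nat"
    and U U' :: "nat \<Rightarrow> real mat"
    and Y :: "nat \<Rightarrow> tensor"
    and \<epsilon> :: real
    and \<epsilon>s :: "nat \<Rightarrow> real"
  assumes "d \<ge> 1"
    and "\<epsilon> > 0"
    and "\<forall>l\<in>{1..k + 1}. dims (Y l) = stream_shape d n (b l)"
    and "tt_cores d n r (acc_size b k) U"
    and "\<forall>l\<in>{1..k}. frob (tensor_diff (Y l) (represented d n b r U l)) \<le> \<epsilon> * frob (Y l)"
    and "\<forall>i\<in>{1..d}. \<epsilon>s i \<ge> 0"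
    and "tt_ice d n (b (k + 1)) r U (Y (k + 1)) \<epsilon>s r' U'"
  shows "tt_cores d n r' (acc_size b (k + 1)) U' \<and>
    (\<forall>l\<in>{1..k}. frob (tensor_diff (Y l) (represented d n b r' U' l)) \<le> \<epsilon> * frob (Y l))"
proof -
  let ?m = "b (k + 1)"
  have r0: "r 0 = 1" and Ui: "\<And>i. i \<in> {1..d} \<Longrightarrow> U i \<in> carrier_mat (r (i - 1) * n i) (r i)"
    and oU: "\<And>i. i \<in> {1..d} \<Longrightarrow> orthonormal_cols (U i)"
    and Ud: "U (d + 1) \<in> carrier_mat (r d) (acc_size b k)"
    using assms(4) unfolding tt_cores_def by auto
  obtain Upad Yt R UR VR where r'0: "r' 0 = 1"
    and Y1: "Yt 1 = mat_of_tensor (reshape (Y (k + 1)) [n 1, (\<Prod>j = 2..d. n j) * ?m])"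
    and Upad1: "Upad 1 = U 1"
    and steps: "\<forall>i\<in>{1..d}.
           R i = (1\<^sub>m (dim_row (Upad i)) - Upad i * transpose_mat (Upad i)) * Yt i \<and>
           truncated_svd (R i) (\<epsilon>s i) (UR i) (VR i) \<and>
           U' i = append_cols (Upad i) (UR i) \<and>
           r' i = r i + dim_col (UR i) \<and>
           (i < d \<longrightarrow>
              Upad (i + 1) =
                reshape_mat
                  (reshape_mat (U (i + 1)) (r i) (n (i + 1) * r (i + 1))
                     @\<^sub>r 0\<^sub>m (dim_col (UR i)) (n (i + 1) * r (i + 1)))
                  (r' i * n (i + 1)) (r (i + 1)) \<and>
              Yt (i + 1) =
                reshape_mat (transpose_mat (U' i) * Yt i)
                  (r' i * n (i + 1)) ((\<Prod>j = i + 2..d. n j) * ?m)) \<and>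
           (i = d \<longrightarrow>
              Upad (d + 1) = U (d + 1) @\<^sub>r 0\<^sub>m (dim_col (UR d)) (dim_col (U (d + 1))) \<and>
              Yt (d + 1) = transpose_mat (U' d) * Yt d)"
    and last: "U' (d + 1) = append_cols (Upad (d + 1)) (Yt (d + 1))"
    using assms(7) unfolding tt_ice_def by blast
  have R: "\<And>i. i \<in> {1..d} \<Longrightarrow>
      R i = (1\<^sub>m (dim_row (Upad i)) - Upad i * transpose_mat (Upad i)) * Yt i"
    and svd: "\<And>i. i \<in> {1..d} \<Longrightarrow> truncated_svd (R i) (\<epsilon>s i) (UR i) (VR i)"
    and U': "\<And>i. i \<in> {1..d} \<Longrightarrow> U' i = append_cols (Upad i) (UR i)"
    and r': "\<And>i. i \<in> {1..d} \<Longrightarrow> r' i = r i + dim_col (UR i)"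
    using steps by blast+
  have Upad_Suc: "Upad (Suc i) = zero_pad (U (Suc i)) (r i) (dim_col (UR i)) (n (Suc i)) (r (Suc i))"
    and Yt_Suc: "Yt (Suc i) = reshape_mat (transpose_mat (U' i) * Yt i)
      (r' i * n (Suc i)) ((\<Prod>j = i + 2..d. n j) * ?m)" if "i \<in> {1..d}" "i < d" for i
    using bspec[OF steps that(1)] that(2)
    unfolding zero_pad_def r'[OF that(1), symmetric] Suc_eq_plus1 by blast+
  have d: "d \<in> {1..d}" using \<open>d \<ge> 1\<close> by simp
  have Upad_last: "Upad (d + 1) = U (d + 1) @\<^sub>r 0\<^sub>m (dim_col (UR d)) (acc_size b k)"
    and Yt_last: "Yt (d + 1) = transpose_mat (U' d) * Yt d"
    using bspec[OF steps d] carrier_matD(2)[OF Ud] by metis+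

  have Yt: "Yt i \<in> carrier_mat (r' (i - 1) * n i) ((\<Prod>j = i + 1..d. n j) * ?m)"
    if i: "i \<in> {1..d}" for i
  proof (cases "i = 1")
    case True
    then show ?thesis
      using Y1 r'0 by (auto simp: mat_of_tensor_def reshape_def numeral_2_eq_2)
  next
    case False
    then obtain i' where "i = Suc i'" "i' \<in> {1..d}" "i' < d"
      using i by (cases i) auto
    then show ?thesis using Yt_Suc[of i'] by (auto intro: carrier_matI)
  qed
  \<comment> \<open>The first core is not padded, in keeping with the first rank being 1 before and after; so one
    description in terms of old and new ranks covers all cores.\<close>
  have Upad: "Upad i \<in> carrier_mat (r' (i - 1) * n i) (r i)"
    and oUpad: "orthonormal_cols (Upad i)"
    and ixUpad: "\<And>s x t. s < r' (i - 1) \<Longrightarrow> x < n i \<Longrightarrow> t < r i \<Longrightarrow>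
      Upad i $$ (s + r' (i - 1) * x, t) = (if s < r (i - 1) then U i $$ (s + r (i - 1) * x, t) else 0)"
    if i: "i \<in> {1..d}" for i
  proof -
    have "Upad i \<in> carrier_mat (r' (i - 1) * n i) (r i) \<and> orthonormal_cols (Upad i) \<and>
      (\<forall>s<r' (i - 1). \<forall>x<n i. \<forall>t<r i. Upad i $$ (s + r' (i - 1) * x, t) =
        (if s < r (i - 1) then U i $$ (s + r (i - 1) * x, t) else 0))"
    proof (cases "i = 1")
      case True
      then show ?thesis using Upad1 Ui[of 1] oU[of 1] r0 r'0 i by auto
    next
      case False
      then obtain i' where i': "i = Suc i'" "i' \<in> {1..d}" "i' < d"
        using i by (cases i) auto
      have U: "U (Suc i') \<in> carrier_mat (r i' * n (Suc i')) (r (Suc i'))"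
        using Ui[OF i] i'(1) by simp
      show ?thesis
        using zero_pad_carrier[of "U (Suc i')" "r i'"] index_zero_pad[OF U]
          orthonormal_zero_pad[OF U] oU[OF i] i'(1) Upad_Suc[OF i'(2,3)] r'[OF i'(2)] by simp
    qed
    then show "Upad i \<in> carrier_mat (r' (i - 1) * n i) (r i)" "orthonormal_cols (Upad i)"
      "\<And>s x t. s < r' (i - 1) \<Longrightarrow> x < n i \<Longrightarrow> t < r i \<Longrightarrow>
        Upad i $$ (s + r' (i - 1) * x, t) = (if s < r (i - 1) then U i $$ (s + r (i - 1) * x, t) else 0)"
      by auto
  qed
  have UR: "UR i \<in> carrier_mat (r' (i - 1) * n i) (dim_col (UR i))"
    and oU': "orthonormal_cols (U' i)" if i: "i \<in> {1..d}" for i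
  proof -
    have "truncated_svd ((1\<^sub>m (r' (i - 1) * n i) - Upad i * transpose_mat (Upad i)) * Yt i)
        (\<epsilon>s i) (UR i) (VR i)"
      using svd[OF i] unfolding R[OF i] carrier_matD(1)[OF Upad[OF i]] .
    from orthonormal_append_residual[OF Upad[OF i] oUpad[OF i] Yt[OF i] this]
    show "UR i \<in> carrier_mat (r' (i - 1) * n i) (dim_col (UR i))" "orthonormal_cols (U' i)"
      unfolding U'[OF i] .
  qed
  have U'_carrier: "U' i \<in> carrier_mat (r' (i - 1) * n i) (r' i)" if i: "i \<in> {1..d}" for i
    using append_cols_carrier[OF Upad[OF i] UR[OF i]] U'[OF i] r'[OF i] by simp
  have Upad_last_carrier: "Upad (d + 1) \<in> carrier_mat (r' d) (acc_size b k)"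
    unfolding Upad_last r'[OF d] using Ud by auto
  have Yt_last_carrier: "Yt (d + 1) \<in> carrier_mat (r' d) ?m"
    unfolding Yt_last using U'_carrier[OF d] Yt[OF d] by auto
  have U'_last_carrier: "U' (d + 1) \<in> carrier_mat (r' d) (acc_size b (k + 1))"
    using append_cols_carrier[OF Upad_last_carrier Yt_last_carrier]
    unfolding last by (simp add: acc_size_def)
  have cores': "tt_cores d n r' (acc_size b (k + 1)) U'"
    using r'0 U'_carrier oU' U'_last_carrier by (auto simp: tt_cores_def)

  have r_le: "r i \<le> r' i" if "i \<in> {1..d}" for i using r'[OF that] by simp
  have core': "entry (core n r' U' i) [s, x, t] = (if s < r (i - 1) then U i $$ (s + r (i - 1) * x, t) else 0)"
    if i: "i \<in> {1..d}" and sxt: "s < r' (i - 1)" "x < n i" "t < r i" for i s x t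
  proof -
    have "entry (core n r' U' i) [s, x, t] = U' i $$ (s + r' (i - 1) * x, t)"
      by (rule entry_core[where ?U = U' and r = r']) (use U'_carrier[OF i] sxt r_le[OF i] in auto)
    also have "\<dots> = Upad i $$ (s + r' (i - 1) * x, t)"
      using index_append_cols[OF Upad[OF i] UR[OF i] less_mult_add[OF sxt(1,2)], of t] sxt U'[OF i] by simp
    finally show ?thesis using ixUpad[OF i sxt] by simp
  qed
  have r_prev: "r (i - 1) \<le> r' (i - 1)" if "i \<in> {1..d}" for i
  proof -
    have "i = 1 \<or> i - 1 \<in> {1..d}" using that by auto
    then show ?thesis using r_le[of "i - 1"] r0 r'0 by auto
  qed

  have same: "entry (represented d n b r' U' l) is = entry (represented d n b r U l) is"
    if l: "l \<in> {1..k}" and "is": "is \<in> indices (stream_shape d n (b l))" for l "is"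
  proof -
    let ?Gs = "map (core n r U) [1..<Suc d]" and ?Gs' = "map (core n r' U') [1..<Suc d]"
    let ?B = "tensor_of_mat (column_block b (U (d + 1)) l)"
    let ?B' = "tensor_of_mat (column_block b (U' (d + 1)) l)"
    have ne: "?Gs \<noteq> []" "?Gs' \<noteq> []" using \<open>d \<ge> 1\<close> by auto
    have dG: "dims (contract_list ?Gs) = (1 # map n [1..<Suc d]) @ [r d]"
      using dims_contract_list_cores[OF \<open>d \<ge> 1\<close>, of n r U] r0 by simp
    have dG': "dims (contract_list ?Gs') = (1 # map n [1..<Suc d]) @ [r' d]"
      using dims_contract_list_cores[OF \<open>d \<ge> 1\<close>, of n r' U'] r'0 by simp
    have dB: "dims ?B = [r d, b l]" "dims ?B' = [r' d, b l]"
      using Ud U'_last_carrier by (auto simp: tensor_of_mat_def column_block_def)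
    have dC: "dims (contract (contract_list ?Gs) ?B) = 1 # stream_shape d n (b l)"
      "dims (contract (contract_list ?Gs') ?B') = 1 # stream_shape d n (b l)"
      unfolding contract_def dG dG' dB by (simp_all add: butlast_append stream_shape_def)
    from "is" obtain js x where js: "is = js @ [x]" "js \<in> indices (map n [1..<Suc d])" and x: "x < b l"
      unfolding stream_shape_def by (rule indices_snocE)
    have len: "length (0 # js) = length (1 # map n [1..<Suc d])"
      using length_indices[OF js(2)] by simp
    \<comment> \<open>Only columns that already existed before the update belong to an earlier tensor.\<close>
    have col: "acc_size b (l - 1) + x < acc_size b k" by (rule column_block_bound[where k = k and b = b, OF l x])
    have entryB: "entry ?B [s, x] = U (d + 1) $$ (s, acc_size b (l - 1) + x)" if "s < r d" for s
      using that x Ud by (simp add: tensor_of_mat_def column_block_def)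
    have entryB': "entry ?B' [s, x] = (if s < r d then U (d + 1) $$ (s, acc_size b (l - 1) + x) else 0)"
      if s: "s < r' d" for s
    proof -
      have "entry ?B' [s, x] = U' (d + 1) $$ (s, acc_size b (l - 1) + x)"
        using s x U'_last_carrier by (simp add: tensor_of_mat_def column_block_def)
      also have "\<dots> = Upad (d + 1) $$ (s, acc_size b (l - 1) + x)"
        unfolding last
        using index_append_cols[OF Upad_last_carrier Yt_last_carrier s, of "acc_size b (l - 1) + x"] col by simp
      finally show ?thesis
        unfolding Upad_last using index_append_zero_rows[OF Ud _ col, of s "dim_col (UR d)"] s r'[OF d] by simp
    qed
    have "entry (contract (contract_list ?Gs') ?B') ((0 # js) @ [x]) =
        entry (contract (contract_list ?Gs) ?B) ((0 # js) @ [x])"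
    proof (rule contract_zero_padding[OF dG dG' dB r_le[OF d] len])
      fix s assume s: "s < r d"
      show "entry (contract_list ?Gs') ((0 # js) @ [s]) = entry (contract_list ?Gs) ((0 # js) @ [s])"
      proof (rule contract_list_cores_zero_padding[where r = r and d = d])
        show "0 # js \<in> indices (r 0 # map n [1..<Suc d])"
          using js(2) r0 by (simp add: indices_def)
      next
        fix i s x t
        assume i: "i \<in> {1..d}" and sxt: "s < r (i - 1)" "x < n i" "t < r i"
        then show "entry (core n r' U' i) [s, x, t] = entry (core n r U i) [s, x, t]"
          using core'[OF i, of s x t] r_prev[OF i] entry_core[of U i r n s x t, OF Ui[OF i] sxt] by simp
      next
        fix i s x t
        assume i: "i \<in> {1..d}" and "r (i - 1) \<le> s" "s < r' (i - 1)" "x < n i" "t < r i"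
        then show "entry (core n r' U' i) [s, x, t] = 0"
          using core'[OF i, of s x t] by simp
      qed (use \<open>d \<ge> 1\<close> r0 r'0 r_le s in auto)
      show "entry ?B' (s # [x]) = entry ?B (s # [x])"
        using s r_le[OF d] entryB entryB' by simp
    next
      fix s assume "r d \<le> s" "s < r' d"
      then show "entry ?B' (s # [x]) = 0" using entryB' by simp
    qed
    \<comment> \<open>Dropping the leading singleton mode amounts to prefixing the multi-index with 0.\<close>
    moreover have "multi_index (1 # stream_shape d n (b l)) (lin_index (stream_shape d n (b l)) is) = 0 # is"
      using multi_index_lin_index[OF "is"] by simp
    ultimately show ?thesis
      unfolding represented_def reshape_def contract_list_snoc[OF ne(1)] contract_list_snoc[OF ne(2)]
        dC tensor.sel by (simp add: js(1))
  qed
  have "frob (tensor_diff (Y l) (represented d n b r' U' l)) =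
      frob (tensor_diff (Y l) (represented d n b r U l))" if l: "l \<in> {1..k}" for l
    using assms(3) l same[OF l] by (simp add: frob_def tensor_diff_def)
  then show ?thesis
    using cores' assms(5) by simp
qed

end
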